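(* Let $l\in\mathbb{N}$. Then there is a constant $C>0$ such that for all $t>0$, $$\sum_{j\in\mathbb{Z}}|\delta_{right}^lG(t,j)|=\|\delta_{right}^lG(t,\cdot)\|_1\le C\min\left\{1,\frac{1}{t^{l/2}}\right\}.$$
   Context: $G(t,n)=e^{-2t}I_n(2t)$ for $t>0$, $n\in\mathbb{Z}$, is the discrete heat kernel, where $I_n(t)=\sum_{m=0}^\infty\frac{1}{m!\,\Gamma(m+n+1)}(t/2)^{2m+n}$ for $n\in\mathbb{N}_0$ and $I_{-n}=I_n$. $\delta_{right}f(n)=f(n)-f(n+1)$ acts in the integer variable, and $\delta_{right}^l$ is its $l$-th iterate. *)

theory Defs
  imports "HOL-Analysis.Analysis"
begin

(* Modified Bessel function of the first kind of integer order.  Taking the absolute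
   value of the order builds in the convention I_(-n) = I_n. *)
definition bessel_I :: "int \<Rightarrow> real \<Rightarrow> real" where
  "bessel_I n t =
     (\<Sum>m. 1 / (fact m * Gamma (real (m + nat \<bar>n\<bar> + 1))) * (t / 2) ^ (2 * m + nat \<bar>n\<bar>))"

definition heat_kernel :: "real \<Rightarrow> int \<Rightarrow> real" where
  "heat_kernel t n = exp (- 2 * t) * bessel_I n (2 * t)"

definition delta_right :: "(int \<Rightarrow> real) \<Rightarrow> int \<Rightarrow> real" where
  "delta_right f n = f n - f (n + 1)"

(* infsum is 0 on families that are not summable, so a bound on l1_norm f is only
   meaningful together with summability of the absolute values of f. *)
definition l1_norm :: "(int \<Rightarrow> real) \<Rightarrow> real" where
  "l1_norm f = (\<Sum>\<^sub>\<infinity>j. \<bar>f j\<bar>)"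

end

theory Submission
  imports Defs
begin

text \<open>
  The heat kernel at time \<open>t\<close> is the distribution of the difference of two independent Poisson
  variables of parameter \<open>t\<close>: the power series of the Bessel function is the convolution of the
  Poisson weights with their mirror image (\<open>heat_kernel_eq_convolution\<close>).  A difference
  operator may be moved onto either factor of a convolution, and convolution is submultiplicative
  for the \<open>\<ell>\<^sup>1\<close> norm, so the mirrored factor, of norm \<open>1\<close>, drops out and
  it is enough to bound the \<open>l\<close>-th difference of the Poisson weights.

  The Poisson weights of parameter \<open>t\<close> are the \<open>l\<close>-fold convolution power of those of
  parameter \<open>s = t / l\<close>.  Giving one difference to each factor bounds the norm by the
  \<open>l\<close>-th power of the norm of a single first difference.  That norm is at most \<open>2\<close>
  for trivial reasons, and it is also at most \<open>1 / sqrt s\<close>: since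
  \<open>s * (p n - p (n + 1)) = (n + 1 - s) * p (n + 1)\<close>, it is the mean absolute deviation of the
  Poisson distribution divided by \<open>s\<close>, while the variance is \<open>s\<close>
  (\<open>l1_norm_delta_right_poisson_le\<close>).  Together the two bounds give the minimum in the
  theorem, with \<open>C = 2 ^ l + sqrt l ^ l\<close>.
\<close>

section \<open>Absolutely summable functions on the integers\<close>

text \<open>
  For real families unconditional summability is the same as absolute summability, so
  \<open>f summable_on UNIV\<close> expresses membership of \<open>f\<close> in \<open>\<ell>\<^sup>1\<close>
  throughout.
\<close>

lemma summable_on_abs_iff:
  fixes f :: "'a \<Rightarrow> real"
  shows "(\<lambda>x. \<bar>f x\<bar>) summable_on A \<longleftrightarrow> f summable_on A"
  unfolding summable_on_iff_abs_summable_on_real[of f] real_norm_def ..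

lemma abs_has_sum_l1_norm:
  fixes f :: "int \<Rightarrow> real"
  assumes "f summable_on UNIV"
  shows "((\<lambda>j. \<bar>f j\<bar>) has_sum l1_norm f) UNIV"
  unfolding l1_norm_def using assms by (intro has_sum_infsum) (simp only: summable_on_abs_iff)

lemma has_sum_int_shift:
  fixes f :: "int \<Rightarrow> real"
  shows "((\<lambda>j. f (j + c)) has_sum S) UNIV \<longleftrightarrow> (f has_sum S) UNIV"
  by (rule has_sum_reindex_bij_witness[where i = "\<lambda>j. j - c" and j = "\<lambda>j. j + c"]) auto

lemma has_sum_int_reflect:
  fixes f :: "int \<Rightarrow> real"
  shows "((\<lambda>j. f (c - j)) has_sum S) UNIV \<longleftrightarrow> (f has_sum S) UNIV"
  by (rule has_sum_reindex_bij_witness[where i = "\<lambda>j. c - j" and j = "\<lambda>j. c - j"]) auto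

lemma has_sum_int_iff_nat:
  fixes f :: "int \<Rightarrow> real"
  assumes "\<And>j. j < 0 \<Longrightarrow> f j = 0"
  shows "(f has_sum S) UNIV \<longleftrightarrow> ((\<lambda>k. f (int k)) has_sum S) UNIV"
proof -
  have "f x = 0" if "x \<notin> range int" for x
    using assms[of x] that by (metis int_nat_eq not_le rangeI not_less)
  then have "(f has_sum S) UNIV \<longleftrightarrow> (f has_sum S) (range int)"
    by (intro has_sum_cong_neutral) auto
  also have "\<dots> \<longleftrightarrow> ((\<lambda>k. f (int k)) has_sum S) UNIV"
    by (subst has_sum_reindex) (auto simp: o_def)
  finally show ?thesis .
qed

lemma summable_delta_right:
  assumes "f summable_on UNIV"
  shows "delta_right f summable_on UNIV"
proof -
  have "(\<lambda>j. f (j + 1)) summable_on UNIV"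
    using assms has_sum_int_shift[of f 1] by (simp add: summable_on_def)
  from summable_on_add[OF assms summable_on_uminus[THEN iffD2, OF this]] show ?thesis
    by (simp add: delta_right_def[abs_def])
qed

lemma l1_norm_delta_right_le:
  assumes "f summable_on UNIV"
  shows "l1_norm (delta_right f) \<le> 2 * l1_norm f"
proof -
  have "((\<lambda>j. \<bar>f j\<bar> + \<bar>f (j + 1)\<bar>) has_sum l1_norm f + l1_norm f) UNIV"
    using abs_has_sum_l1_norm[OF assms]
    by (intro has_sum_add) (simp_all add: has_sum_int_shift[of "\<lambda>j. \<bar>f j\<bar>"])
  with abs_has_sum_l1_norm[OF summable_delta_right[OF assms]]
  have "l1_norm (delta_right f) \<le> l1_norm f + l1_norm f"
    by (rule has_sum_mono) (auto simp: delta_right_def)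
  then show ?thesis by simp
qed

section \<open>Convolution and differences\<close>

definition convolution :: "(int \<Rightarrow> real) \<Rightarrow> (int \<Rightarrow> real) \<Rightarrow> int \<Rightarrow> real" where
  "convolution f g n = (\<Sum>\<^sub>\<infinity>k. f k * g (n - k))"

text \<open>
  The substitution \<open>m = n - k\<close> turns this double family into a product family.
  All the summability that is needed for convolutions comes from here.
\<close>
lemma abs_convolution_family_has_sum:
  assumes f: "f summable_on UNIV" and g: "g summable_on UNIV"
  shows "((\<lambda>(n, k). \<bar>f k * g (n - k)\<bar>) has_sum (l1_norm f * l1_norm g)) (UNIV \<times> UNIV)"
proof -
  let ?h = "\<lambda>(k, m). \<bar>f k\<bar> * \<bar>g m\<bar>"
  have row: "((\<lambda>m. ?h (k, m)) has_sum (\<bar>f k\<bar> * l1_norm g)) UNIV" for k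
    using has_sum_cmult_right[OF abs_has_sum_l1_norm[OF g]] by simp
  have total: "((\<lambda>k. \<bar>f k\<bar> * l1_norm g) has_sum (l1_norm f * l1_norm g)) UNIV"
    using abs_has_sum_l1_norm[OF f] by (rule has_sum_cmult_left)
  have "(?h has_sum (l1_norm f * l1_norm g)) (UNIV \<times> UNIV)"
    using row total
    by (rule has_sum_SigmaI[where f = ?h])
       (rule summable_on_SigmaI[where f = ?h, OF row has_sum_imp_summable[OF total]], auto)
  also have "?this \<longleftrightarrow> ?thesis"
    by (rule has_sum_reindex_bij_witness[where i = "\<lambda>(n, k). (k, n - k)"
          and j = "\<lambda>(k, m). (k + m, k)"])
       (auto simp: abs_mult)
  finally show ?thesis .
qed

lemma convolution_has_sum:
  assumes "f summable_on UNIV" "g summable_on UNIV"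
  shows "((\<lambda>k. f k * g (n - k)) has_sum convolution f g n) UNIV"
proof -
  have "(\<lambda>(n, k). f k * g (n - k)) summable_on UNIV \<times> UNIV"
    using abs_convolution_family_has_sum[OF assms, THEN has_sum_imp_summable]
    by (simp only: case_prod_unfold summable_on_abs_iff)
  from summable_on_SigmaD1[OF this, of n] show ?thesis
    unfolding convolution_def by (auto intro: has_sum_infsum)
qed

lemma
  assumes f: "f summable_on UNIV" and g: "g summable_on UNIV"
  shows summable_convolution: "convolution f g summable_on UNIV"
    and l1_norm_convolution_le: "l1_norm (convolution f g) \<le> l1_norm f * l1_norm g"
proof -
  let ?a = "\<lambda>n k. \<bar>f k * g (n - k)\<bar>"
  have row: "(?a n has_sum infsum (?a n) UNIV) UNIV" for n
    using convolution_has_sum[OF f g, of n, THEN has_sum_imp_summable]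
    by (intro has_sum_infsum) (simp only: summable_on_abs_iff)
  have total: "((\<lambda>n. infsum (?a n) UNIV) has_sum (l1_norm f * l1_norm g)) UNIV"
    using abs_convolution_family_has_sum[OF f g]
    by (rule has_sum_SigmaD) (use row in simp)
  have le: "\<bar>convolution f g n\<bar> \<le> infsum (?a n) UNIV" for n
    using norm_infsum_le[OF convolution_has_sum[OF f g, of n] row[of n]] by simp
  show *: "convolution f g summable_on UNIV"
    unfolding summable_on_abs_iff[symmetric, of "convolution f g"]
    by (rule summable_on_comparison_test[OF has_sum_imp_summable[OF total]]) (use le in auto)
  show "l1_norm (convolution f g) \<le> l1_norm f * l1_norm g"
    using abs_has_sum_l1_norm[OF *] total by (rule has_sum_mono) (rule le)
qed

lemma convolution_commute: "convolution f g = convolution g f"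
proof
  fix n
  show "convolution f g n = convolution g f n"
    unfolding convolution_def
    by (rule infsum_reindex_bij_witness[where i = "\<lambda>k. n - k" and j = "\<lambda>k. n - k"]) auto
qed

lemma delta_right_convolution:
  assumes f: "f summable_on UNIV" and g: "g summable_on UNIV"
  shows "delta_right (convolution f g) = convolution f (delta_right g)"
proof
  fix n
  have "((\<lambda>k. f k * g (n - k) + - (f k * g (n + 1 - k)))
          has_sum (convolution f g n + - convolution f g (n + 1))) UNIV"
    by (intro has_sum_add has_sum_uminusI convolution_has_sum f g)
  then have "((\<lambda>k. f k * delta_right g (n - k))
          has_sum (convolution f g n - convolution f g (n + 1))) UNIV"
    by (simp add: delta_right_def algebra_simps)
  then show "delta_right (convolution f g) n = convolution f (delta_right g) n"
    by (simp add: convolution_def delta_right_def infsumI)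
qed

lemma summable_delta_right_iterate:
  assumes "f summable_on UNIV"
  shows "(delta_right ^^ k) f summable_on UNIV"
  by (induction k) (auto intro: assms summable_delta_right)

text \<open>
  By commutativity of convolution the differences may equally be put on the first factor;
  the proof of the bound for the Poisson weights uses both forms.
\<close>
lemma delta_right_iterate_convolution:
  assumes f: "f summable_on UNIV" and g: "g summable_on UNIV"
  shows "(delta_right ^^ k) (convolution f g) = convolution f ((delta_right ^^ k) g)"
  by (induction k)
     (simp_all add: delta_right_convolution f g summable_delta_right_iterate)

section \<open>Poisson weights\<close>

definition poisson :: "real \<Rightarrow> int \<Rightarrow> real" where
  "poisson s n = (if n < 0 then 0 else exp (- s) * s ^ nat n / fact (nat n))"

lemma poisson_nonneg: "s \<ge> 0 \<Longrightarrow> poisson s n \<ge> 0"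
  by (simp add: poisson_def)

lemma poisson_has_sum:
  assumes "s \<ge> 0"
  shows "(poisson s has_sum 1) UNIV"
proof (subst has_sum_int_iff_nat)
  have "(\<lambda>k. exp (- s) * (s ^ k /\<^sub>R fact k)) sums (exp (- s) * exp s)"
    by (intro sums_mult exp_converges)
  moreover have "exp (- s) * exp s = 1"
    by (simp flip: exp_add)
  moreover have "exp (- s) * (s ^ k /\<^sub>R fact k) = poisson s (int k)" for k
    by (simp add: poisson_def divide_inverse)
  ultimately have "(\<lambda>k. poisson s (int k)) sums 1"
    by simp
  then show "((\<lambda>k. poisson s (int k)) has_sum 1) UNIV"
    by (rule sums_nonneg_imp_has_sum) (use assms poisson_nonneg in auto)
qed (simp add: poisson_def)

lemma l1_norm_poisson:
  assumes "s \<ge> 0"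
  shows "l1_norm (poisson s) = 1"
  using poisson_has_sum[OF assms] poisson_nonneg[OF assms] by (simp add: l1_norm_def infsumI)

lemma summable_poisson: "s \<ge> 0 \<Longrightarrow> poisson s summable_on UNIV"
  using poisson_has_sum has_sum_imp_summable by blast

text \<open>
  This recursion holds on all of the integers, the boundary point \<open>n = -1\<close> included.  It
  yields the moments below by shifting the index, and it expresses the first difference as a
  multiple of the next weight.
\<close>
lemma poisson_ratio: "of_int (n + 1) * poisson s (n + 1) = s * poisson s n"
proof -
  consider "n < -1" | "n = -1" | "n \<ge> 0" by linarith
  then show ?thesis
  proof cases
    case 3
    then have "nat (n + 1) = Suc (nat n)" "of_int (n + 1) = real (Suc (nat n))" by linarith+
    with 3 show ?thesis by (simp add: poisson_def del: of_nat_Suc of_int_add) 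
  qed (auto simp: poisson_def)
qed

lemma poisson_variance:
  assumes "s \<ge> 0"
  shows "((\<lambda>n. (of_int n - s)\<^sup>2 * poisson s n) has_sum s) UNIV"
proof -
  have mean: "((\<lambda>n. of_int n * poisson s n) has_sum s) UNIV"
    using has_sum_cmult_right[OF poisson_has_sum[OF assms], of s]
    by (subst has_sum_int_shift[of _ 1, symmetric]) (simp only: poisson_ratio mult_1_right)
  have "((\<lambda>n. s * (of_int n * poisson s n + poisson s n)) has_sum (s * (s + 1))) UNIV"
    by (intro has_sum_cmult_right has_sum_add mean poisson_has_sum assms)
  moreover have "s * (of_int n * poisson s n + poisson s n) = (of_int (n + 1))\<^sup>2 * poisson s (n + 1)" for n
  proof -
    have "s * (of_int n * poisson s n + poisson s n) = of_int (n + 1) * (s * poisson s n)"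
      by (simp add: algebra_simps)
    then show ?thesis by (simp only: poisson_ratio[symmetric] power2_eq_square mult.assoc)
  qed
  ultimately have square: "((\<lambda>n. (of_int n)\<^sup>2 * poisson s n) has_sum (s * (s + 1))) UNIV"
    by (subst has_sum_int_shift[of _ 1, symmetric]) simp
  have "((\<lambda>n. (of_int n)\<^sup>2 * poisson s n + ((- 2 * s) * (of_int n * poisson s n) + s\<^sup>2 * poisson s n))
      has_sum (s * (s + 1) + ((- 2 * s) * s + s\<^sup>2 * 1))) UNIV"
    by (intro has_sum_add has_sum_cmult_right square mean poisson_has_sum assms)
  then show ?thesis
    by (simp add: algebra_simps power2_eq_square)
qed

text \<open>
  By the recursion the norm is the mean of \<open>\<bar>n - s\<bar> / s\<close> under the Poisson
  distribution.  Instead of the Cauchy--Schwarz inequality the proof uses its pointwise form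
  \<open>2 * \<bar>x\<bar> \<le> x\<^sup>2 / sqrt s + sqrt s\<close>, which is balanced at the
  standard deviation \<open>sqrt s\<close>; summing it needs only the variance and the total mass.
\<close>
lemma l1_norm_delta_right_poisson_le:
  assumes "s > 0"
  shows "l1_norm (delta_right (poisson s)) \<le> 1 / sqrt s"
proof -
  let ?b = "\<lambda>n. (of_int n - s)\<^sup>2 / sqrt s * poisson s n + sqrt s * poisson s n"
  have "((\<lambda>n. inverse (sqrt s) * ((of_int n - s)\<^sup>2 * poisson s n) + sqrt s * poisson s n)
          has_sum (inverse (sqrt s) * s + sqrt s * 1)) UNIV"
    using assms by (intro has_sum_add has_sum_cmult_right poisson_variance poisson_has_sum) auto
  then have "(?b has_sum (2 * sqrt s)) UNIV"
    using assms by (simp add: field_simps real_div_sqrt)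
  then have b: "((\<lambda>n. 1 / (2 * s) * ?b (n + 1)) has_sum (1 / (2 * s) * (2 * sqrt s))) UNIV"
    by (intro has_sum_cmult_right) (rule has_sum_int_shift[of ?b 1, THEN iffD2])
  have le: "\<bar>delta_right (poisson s) n\<bar> \<le> 1 / (2 * s) * ?b (n + 1)" for n
  proof -
    let ?x = "of_int (n + 1) - s" and ?p = "poisson s (n + 1)"
    have "s * delta_right (poisson s) n = ?x * ?p"
      using poisson_ratio[of n s] by (simp add: delta_right_def algebra_simps)
    then have *: "s * \<bar>delta_right (poisson s) n\<bar> = \<bar>?x\<bar> * ?p"
      using assms poisson_nonneg[of s "n + 1"] by (metis abs_mult abs_of_nonneg less_imp_le)
    have "0 \<le> (\<bar>?x\<bar> - sqrt s)\<^sup>2 / sqrt s" using assms by simp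
    also have "\<dots> = ?x\<^sup>2 / sqrt s + sqrt s - 2 * \<bar>?x\<bar>"
      using assms by (simp add: field_simps power2_diff)
    finally have "2 * \<bar>?x\<bar> * ?p \<le> (?x\<^sup>2 / sqrt s + sqrt s) * ?p"
      using assms poisson_nonneg[of s "n + 1"] by (intro mult_right_mono) auto
    with * have "2 * s * \<bar>delta_right (poisson s) n\<bar> \<le> ?b (n + 1)"
      by (simp add: algebra_simps)
    then show ?thesis using assms by (simp add: field_simps)
  qed
  have "l1_norm (delta_right (poisson s)) \<le> 1 / (2 * s) * (2 * sqrt s)"
    using abs_has_sum_l1_norm[OF summable_delta_right[OF summable_poisson]] b le assms
    by (intro has_sum_mono[OF _ b le]) auto
  also have "\<dots> = 1 / sqrt s"
    using assms by (simp add: real_sqrt_divide field_simps)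
  finally show ?thesis .
qed

text \<open>The semigroup property is the binomial theorem.\<close>
lemma convolution_poisson:
  "convolution (poisson s) (poisson t) = poisson (s + t)"
proof
  fix n :: int
  show "convolution (poisson s) (poisson t) n = poisson (s + t) n"
  proof (cases "n < 0")
    case True
    then show ?thesis by (simp add: convolution_def poisson_def infsum_0)
  next
    case False
    then obtain N where n: "n = int N"
      using nonneg_int_cases[of n] by auto
    have exp: "exp (- (s + t)) = exp (- s) * exp (- t)"
      by (simp flip: exp_add)
    have "convolution (poisson s) (poisson t) n
        = (\<Sum>\<^sub>\<infinity>k\<in>int ` {..N}. poisson s k * poisson t (n - k))"
      unfolding convolution_def
    proof (rule infsum_cong_neutral)
      fix k assume "k \<in> UNIV - int ` {..N}"
      moreover have "k \<in> int ` {..N}" if "0 \<le> k" "k \<le> n"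
        using that by (intro image_eqI[of _ _ "nat k"]) (auto simp: n)
      ultimately have "k < 0 \<or> n - k < 0"
        by force
      then show "poisson s k * poisson t (n - k) = 0" by (auto simp: poisson_def)
    qed auto
    also have "\<dots> = (\<Sum>k\<le>N. poisson s (int k) * poisson t (n - int k))"
      by (simp add: sum.reindex)
    also have "\<dots> = (\<Sum>k\<le>N. exp (- (s + t)) / fact N * (of_nat (N choose k) * s ^ k * t ^ (N - k)))"
    proof (rule sum.cong)
      fix k assume "k \<in> {..N}"
      then have "nat (n - int k) = N - k" "k \<le> N" by (auto simp: n)
      then show "poisson s (int k) * poisson t (n - int k)
          = exp (- (s + t)) / fact N * (of_nat (N choose k) * s ^ k * t ^ (N - k))"
        unfolding exp by (simp add: poisson_def n binomial_fact)
    qed simp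
    also have "\<dots> = exp (- (s + t)) / fact N * (s + t) ^ N"
      by (simp add: binomial_ring sum_distrib_left)
    finally show ?thesis by (simp add: poisson_def n)
  qed
qed

text \<open>
  Each convolution factor of parameter \<open>s\<close> absorbs one difference.  The base case is the
  convolution unit: \<open>poisson 0\<close> is the point mass at \<open>0\<close>, because
  \<open>0 ^ 0 = 1\<close>.
\<close>
lemma l1_norm_delta_right_iterate_poisson_le:
  assumes "s \<ge> 0"
  shows "l1_norm ((delta_right ^^ k) (poisson (real k * s))) \<le> l1_norm (delta_right (poisson s)) ^ k"
proof (induction k)
  case 0
  then show ?case by (simp add: l1_norm_poisson)
next
  case (Suc k)
  let ?P = "poisson s" and ?Q = "poisson (real k * s)"
  have P: "?P summable_on UNIV" and Q: "?Q summable_on UNIV"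
    using assms by (auto intro: summable_poisson)
  have "poisson (real (Suc k) * s) = convolution ?P ?Q"
    by (simp add: convolution_poisson algebra_simps)
  then have "(delta_right ^^ Suc k) (poisson (real (Suc k) * s))
      = delta_right (convolution ?P ((delta_right ^^ k) ?Q))"
    by (simp add: delta_right_iterate_convolution[OF P Q])
  also have "\<dots> = convolution ((delta_right ^^ k) ?Q) (delta_right ?P)"
    by (subst convolution_commute)
       (intro delta_right_convolution summable_delta_right_iterate P Q)
  finally have "l1_norm ((delta_right ^^ Suc k) (poisson (real (Suc k) * s)))
      \<le> l1_norm ((delta_right ^^ k) ?Q) * l1_norm (delta_right ?P)"
    by (simp only:)
       (intro l1_norm_convolution_le summable_delta_right_iterate summable_delta_right P Q)
  also have "\<dots> \<le> l1_norm (delta_right ?P) ^ k * l1_norm (delta_right ?P)"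
    using Suc.IH by (rule mult_right_mono) (simp add: l1_norm_def infsum_nonneg)
  finally show ?case by (simp add: mult.commute)
qed

section \<open>The heat kernel\<close>

lemma summable_reflected_poisson: "s \<ge> 0 \<Longrightarrow> (\<lambda>n. poisson s (- n)) summable_on UNIV"
  using poisson_has_sum[of s] has_sum_int_reflect[of "poisson s" 0 1]
  by (auto simp: summable_on_def)

lemma l1_norm_reflected_poisson: "s \<ge> 0 \<Longrightarrow> l1_norm (\<lambda>n. poisson s (- n)) = 1"
  using poisson_has_sum[of s] has_sum_int_reflect[of "poisson s" 0 1] poisson_nonneg[of s]
  by (simp add: l1_norm_def infsumI)

text \<open>
  The summands of the convolution at \<open>n\<close> that can be nonzero are the products of two Poisson
  weights at distance \<open>\<bar>n\<bar>\<close>, and these are the terms of the Bessel series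
  multiplied by \<open>exp (- 2 * t)\<close>.
\<close>
lemma heat_kernel_eq_convolution:
  assumes "t \<ge> 0"
  shows "heat_kernel t = convolution (\<lambda>n. poisson t (- n)) (poisson t)"
proof
  fix n :: int
  let ?S = "convolution (\<lambda>n. poisson t (- n)) (poisson t) n"
  define a where "a = nat \<bar>n\<bar>"
  define c where "c m = 1 / (fact m * Gamma (real (m + a + 1))) * t ^ (2 * m + a)" for m
  have gamma: "Gamma (real (m + a + 1)) = fact (m + a)" for m
    using Gamma_fact[of "m + a", where 'a = real] by (simp add: add_ac)
  have weights: "exp (- 2 * t) * c m = poisson t (int m) * poisson t (int (m + a))" for m
  proof -
    have "exp (- 2 * t) = exp (- t) * exp (- t)" by (simp flip: exp_add)
    moreover have "t ^ (2 * m + a) = t ^ m * t ^ (m + a)"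
      by (metis mult_2 add.assoc power_add)
    moreover have "poisson t (int k) = exp (- t) * t ^ k / fact k" for k
      by (simp add: poisson_def)
    ultimately show ?thesis
      unfolding c_def gamma by (simp del: of_nat_add)
  qed
  \<comment> \<open>Only the summands with \<open>k \<le> d\<close> can be nonzero; \<open>j = d - k\<close> counts them.\<close>
  define d where "d = min n 0"
  define h where "h j = poisson t (- (d - j)) * poisson t (n - (d - j))" for j
  have "(h has_sum ?S) UNIV"
    using convolution_has_sum[OF summable_reflected_poisson summable_poisson, of t t n] assms
    unfolding h_def has_sum_int_reflect[of "\<lambda>k. poisson t (- k) * poisson t (n - k)"] by simp
  moreover have "h j = 0" if "j < 0" for j
    using that by (auto simp: h_def d_def poisson_def min_def)
  moreover have "h (int m) = exp (- 2 * t) * c m" for m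
  proof (cases "n \<ge> 0")
    case True
    then have "- (d - int m) = int m" "n - (d - int m) = int (m + a)" by (auto simp: d_def a_def)
    then show ?thesis by (simp only: h_def weights)
  next
    case False
    then have "- (d - int m) = int (m + a)" "n - (d - int m) = int m" by (auto simp: d_def a_def)
    then show ?thesis by (simp only: h_def weights mult.commute[of "poisson t (int (m + a))"])
  qed
  ultimately have "(\<lambda>m. exp (- 2 * t) * c m) sums ?S"
    using has_sum_int_iff_nat[of h] by (auto intro: has_sum_imp_sums)
  then have "(\<lambda>m. exp (2 * t) * (exp (- 2 * t) * c m)) sums (exp (2 * t) * ?S)"
    by (rule sums_mult)
  then have "c sums (exp (2 * t) * ?S)"
    by (simp add: mult.assoc[symmetric] flip: exp_add)
  then have "bessel_I n (2 * t) = exp (2 * t) * ?S"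
    by (simp add: bessel_I_def c_def[abs_def] a_def[symmetric] sums_iff)
  then show "heat_kernel t n = ?S"
    by (simp add: heat_kernel_def mult.assoc[symmetric] flip: exp_add)
qed

lemma summable_heat_kernel: "t \<ge> 0 \<Longrightarrow> heat_kernel t summable_on UNIV"
  by (simp add: heat_kernel_eq_convolution summable_convolution summable_reflected_poisson
      summable_poisson)

lemma l1_norm_delta_right_iterate_heat_kernel_le:
  assumes "t \<ge> 0"
  shows "l1_norm ((delta_right ^^ l) (heat_kernel t)) \<le> l1_norm ((delta_right ^^ l) (poisson t))"
proof -
  have "l1_norm ((delta_right ^^ l) (heat_kernel t))
      \<le> l1_norm (\<lambda>n. poisson t (- n)) * l1_norm ((delta_right ^^ l) (poisson t))"
    using assms
    by (simp only: heat_kernel_eq_convolution delta_right_iterate_convolution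
        summable_reflected_poisson summable_poisson)
       (intro l1_norm_convolution_le summable_delta_right_iterate summable_reflected_poisson
        summable_poisson)
  with assms show ?thesis by (simp add: l1_norm_reflected_poisson)
qed

theorem lemma6:
  fixes l :: nat
  assumes "l \<ge> 1"
  shows "\<exists>C::real. C > 0 \<and> (\<forall>t::real. t > 0 \<longrightarrow>
    (\<lambda>j. \<bar>(delta_right ^^ l) (heat_kernel t) j\<bar>) summable_on UNIV \<and>
    (\<Sum>\<^sub>\<infinity>j. \<bar>(delta_right ^^ l) (heat_kernel t) j\<bar>) = l1_norm ((delta_right ^^ l) (heat_kernel t)) \<and>
    l1_norm ((delta_right ^^ l) (heat_kernel t)) \<le> C * min 1 (1 / t powr (real l / 2)))"
proof (intro exI[of _ "2 ^ l + sqrt (real l) ^ l"] conjI allI impI)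
  show "2 ^ l + sqrt (real l) ^ l > 0"
    by (intro add_pos_nonneg) auto
next
  fix t :: real
  assume t: "t > 0"
  show "(\<lambda>j. \<bar>(delta_right ^^ l) (heat_kernel t) j\<bar>) summable_on UNIV"
    using summable_delta_right_iterate[OF summable_heat_kernel, of t l] t
    by (simp only: summable_on_abs_iff less_imp_le)
  show "(\<Sum>\<^sub>\<infinity>j. \<bar>(delta_right ^^ l) (heat_kernel t) j\<bar>) = l1_norm ((delta_right ^^ l) (heat_kernel t))"
    by (simp add: l1_norm_def)
  let ?N = "l1_norm ((delta_right ^^ l) (heat_kernel t))"
  define s where "s = t / real l"
  have s: "s > 0" "real l * s = t"
    using t assms by (auto simp: s_def)
  define B where "B = l1_norm (delta_right (poisson s))"
  have "B \<ge> 0"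
    by (simp add: B_def l1_norm_def infsum_nonneg)
  have "?N \<le> l1_norm ((delta_right ^^ l) (poisson t))"
    using t by (intro l1_norm_delta_right_iterate_heat_kernel_le) simp
  also have "\<dots> \<le> B ^ l"
    using l1_norm_delta_right_iterate_poisson_le[of s l] s by (simp add: B_def)
  finally have N: "?N \<le> B ^ l" .
  have "B \<le> 2"
    using l1_norm_delta_right_le[OF summable_poisson, of s] s by (simp add: B_def l1_norm_poisson)
  then have small: "?N \<le> 2 ^ l"
    using N \<open>B \<ge> 0\<close> by (meson order_trans power_mono)
  have "B \<le> sqrt (real l) / sqrt t"
    using l1_norm_delta_right_poisson_le[OF s(1)] by (simp add: B_def s_def real_sqrt_divide)
  then have "?N \<le> (sqrt (real l) / sqrt t) ^ l"
    using N \<open>B \<ge> 0\<close> by (meson order_trans power_mono)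
  also have "\<dots> = sqrt (real l) ^ l / t powr (real l / 2)"
    using t by (simp add: power_divide powr_half_sqrt[symmetric] powr_powr flip: powr_realpow)
  finally have large: "?N \<le> sqrt (real l) ^ l / t powr (real l / 2)" .
  show "?N \<le> (2 ^ l + sqrt (real l) ^ l) * min 1 (1 / t powr (real l / 2))"
  proof (cases "1 \<le> 1 / t powr (real l / 2)")
    case True
    have "?N \<le> 2 ^ l + sqrt (real l) ^ l"
      using small by (simp add: add_increasing2)
    with True show ?thesis by simp
  next
    case False
    have "sqrt (real l) ^ l / t powr (real l / 2)
        \<le> (2 ^ l + sqrt (real l) ^ l) / t powr (real l / 2)"
      by (intro divide_right_mono) auto
    with False large show ?thesis by simp
  qed
qed

end
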